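(* $D(3,\mathbb{Z}^2)=\frac{1}{5}$ and $d(3,\mathbb{Z}^2)=\frac{1}{17}$.
   Context: Notation: $\mathbb{N}=\{1,2,3,\dots\}$, $[n]=\{1,\dots,n\}$. Let $k\ge 3$ be an integer. For $m,n\in\mathbb{N}$, the board $B=[m]\times[n]\subseteq\mathbb{Z}^2$ has as its $k$-lines all sets $\{p+j\vec d: 0\le j\le k-1\}$ with $p\in B$ and $\vec d\in\{-1,0,1\}^2\setminus\{0\}$ that are contained in $B$. A configuration of $B$ is a subset $S\subseteq B$ with $|L\setminus S|\ge 2$ for every $k$-line $L$ of $B$. A saturated configuration is a configuration that is maximal with respect to inclusion among configurations; $\mathcal{S}_k(B)$ is the set of saturated configurations. Define $D(k,B)=\max_{S\in\mathcal{S}_k(B)}|S|/|B|$ and $d(k,B)=\min_{S\in\mathcal{S}_k(B)}|S|/|B|$. Finally $D(k,\mathbb{Z}^2)=\lim_{t\to\infty}D(k,[m(t)]\times[n(t)])$ and $d(k,\mathbb{Z}^2)=\lim_{t\to\infty}d(k,[m(t)]\times[n(t)])$, where $m,n:\mathbb{N}\to\mathbb{N}$ are arbitrary maps with $m(t),n(t)\to\infty$; these limits exist and do not depend on the choice of $m,n$ (in particular one may take $m(t)=n(t)=t$). *)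

theory Defs
  imports Complex_Main
begin

type_synonym point = "int \<times> int"

definition board :: "nat \<Rightarrow> nat \<Rightarrow> point set" where
  "board m n = {1..int m} \<times> {1..int n}"

definition directions :: "point set" where
  "directions = {-1, 0, 1} \<times> {-1, 0, 1} - {(0, 0)}"

definition k_line :: "nat \<Rightarrow> point \<Rightarrow> point \<Rightarrow> point set" where
  "k_line k p v = (\<lambda>j::nat. (fst p + int j * fst v, snd p + int j * snd v)) ` {..<k}"

definition k_lines :: "nat \<Rightarrow> point set \<Rightarrow> point set set" where
  "k_lines k B = {L. L \<subseteq> B \<and> (\<exists>p\<in>B. \<exists>v\<in>directions. L = k_line k p v)}"

definition configuration :: "nat \<Rightarrow> point set \<Rightarrow> point set \<Rightarrow> bool" where
  "configuration k B S \<longleftrightarrow> S \<subseteq> B \<and> (\<forall>L\<in>k_lines k B. card (L - S) \<ge> 2)"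

definition saturated_configurations :: "nat \<Rightarrow> point set \<Rightarrow> point set set" where
  "saturated_configurations k B =
     {S. configuration k B S \<and> (\<forall>T. configuration k B T \<and> S \<subseteq> T \<longrightarrow> T = S)}"

definition max_density :: "nat \<Rightarrow> point set \<Rightarrow> real" where
  "max_density k B = Max ((\<lambda>S. real (card S) / real (card B)) ` saturated_configurations k B)"

definition min_density :: "nat \<Rightarrow> point set \<Rightarrow> real" where
  "min_density k B = Min ((\<lambda>S. real (card S) / real (card B)) ` saturated_configurations k B)"

text \<open>Sequences of boards are indexed by all of \<open>nat\<close>, but positivity of the side lengths is
  only demanded from index 1 on, so that \<open>m t = n t = t\<close> is covered.\<close>

definition board_limit :: "(point set \<Rightarrow> real) \<Rightarrow> real \<Rightarrow> bool" where
  "board_limit f l \<longleftrightarrow>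
     (\<forall>m n :: nat \<Rightarrow> nat.
        (\<forall>t\<ge>1. m t \<ge> 1 \<and> n t \<ge> 1) \<and>
        filterlim m at_top sequentially \<and> filterlim n at_top sequentially \<longrightarrow>
        (\<lambda>t. f (board (m t) (n t))) \<longlonglongrightarrow> l)"

text \<open>These are meaningful only where the limit exists; existence is expressed separately, by
  \<open>board_limit (max_density k) (plane_max_density k)\<close> and its analogue for the minimum.\<close>

definition plane_max_density :: "nat \<Rightarrow> real" where
  "plane_max_density k = (THE l. board_limit (max_density k) l)"

definition plane_min_density :: "nat \<Rightarrow> real" where
  "plane_min_density k = (THE l. board_limit (min_density k) l)"

end

theory Submission
  imports Defs
begin

text \<open>
  A set is a configuration for \<open>k = 3\<close> iff no \<open>3\<close>-line contains two of its points. Away from the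
  border of the board this says that no two points differ by one of the 16 vectors \<open>v\<close>, \<open>2 v\<close> with
  \<open>v\<close> a direction: configurations are independent sets and saturated configurations are maximal
  independent sets of the graph of queen moves of length at most two. Only points within distance
  two of the border can behave differently, and on an \<open>m \<times> n\<close> board there are at most
  \<open>4 (m + n)\<close> of them, which is negligible against \<open>m n\<close>.

  \<^bold>\<open>Minimum.\<close> In a saturated configuration each point of the board lies in the configuration or is
  one queen step away from it. A point together with its queen steps covers 17 points, so the
  density is at least \<open>1/17\<close> (\<open>saturated_card_lower\<close>). This is attained by a perfect code: modulo
  17 the map \<open>(x, y) \<mapsto> x + 4 y\<close> sends the 16 queen steps bijectively to the nonzero residues, so
  each of its residue classes is independent and dominates the plane. Extending such a class to a
  saturated configuration adds points only near the border.

  \<^bold>\<open>Maximum.\<close> Any two points of a plus pentomino differ by a queen step, hence the pluses around the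
  points of a configuration are disjoint and the density is at most \<open>1/5\<close> up to border effects
  (\<open>configuration_card_upper\<close>). Modulo 5 the map \<open>(x, y) \<mapsto> x + 2 y\<close> sends no queen step to 0, so
  its residue classes are configurations.

  In both cases averaging over the residue classes yields one whose density on the given board is
  on the desired side of \<open>1/17\<close> or \<open>1/5\<close>; the points of a fixed class need not be counted.
\<close>

section \<open>Configurations as independent sets\<close>

definition queen_steps :: "point set" where
  "queen_steps = directions \<union> (\<lambda>v. (2 * fst v, 2 * snd v)) ` directions"

definition inner :: "nat \<Rightarrow> nat \<Rightarrow> point set" where
  "inner m n = {3..int m - 2} \<times> {3..int n - 2}"

lemma directions_eq:
  "directions = {(-1, -1), (-1, 0), (-1, 1), (0, -1), (0, 1), (1, -1), (1, 0), (1, 1)}"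
  unfolding directions_def by auto

lemma queen_steps_eq:
  "queen_steps = {(-1, -1), (-1, 0), (-1, 1), (0, -1), (0, 1), (1, -1), (1, 0), (1, 1),
     (-2, -2), (-2, 0), (-2, 2), (0, -2), (0, 2), (2, -2), (2, 0), (2, 2)}"
  unfolding queen_steps_def directions_eq by auto

lemma k_line_3:
  "k_line 3 p v = {p, (fst p + fst v, snd p + snd v), (fst p + 2 * fst v, snd p + 2 * snd v)}"
proof -
  have "{..<3::nat} = {0, 1, 2}" by auto
  then show ?thesis unfolding k_line_def by simp
qed

lemma card_k_line_3:
  assumes "v \<in> directions"
  shows "card (k_line 3 p v) = 3"
  using assms unfolding k_line_3 directions_eq by (cases p) auto

lemma finite_board [simp]: "finite (board m n)"
  and card_board [simp]: "card (board m n) = m * n"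
  unfolding board_def by simp_all

lemma card_minus_ge_2_iff:
  assumes "card L = 3"
  shows "card (L - S) \<ge> 2 \<longleftrightarrow> (\<forall>p\<in>L \<inter> S. \<forall>q\<in>L \<inter> S. p = q)"
proof -
  have fin: "finite L" using assms card.infinite by fastforce
  have "card (L - S) = 3 - card (L \<inter> S)"
    using assms fin by (metis card_Diff_subset_Int finite_Int)
  moreover have "card (L \<inter> S) \<le> 1 \<longleftrightarrow> (\<forall>p\<in>L \<inter> S. \<forall>q\<in>L \<inter> S. p = q)"
    using fin by (simp add: card_le_Suc0_iff_eq)
  ultimately show ?thesis by linarith
qed

lemma configuration_3_iff:
  "configuration 3 B S \<longleftrightarrow>
     S \<subseteq> B \<and> (\<forall>L\<in>k_lines 3 B. \<forall>p\<in>L \<inter> S. \<forall>q\<in>L \<inter> S. p = q)"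
proof -
  have "card L = 3" if "L \<in> k_lines 3 B" for L
    using that card_k_line_3 unfolding k_lines_def by auto
  then show ?thesis unfolding configuration_def by (simp add: card_minus_ge_2_iff)
qed

lemma line_imp_queen_step:
  assumes "L \<in> k_lines 3 B" "p \<in> L" "q \<in> L" "p \<noteq> q"
  shows "(fst q - fst p, snd q - snd p) \<in> queen_steps"
proof -
  obtain a v where v: "v \<in> directions" and L: "L = k_line 3 a v"
    using assms(1) unfolding k_lines_def by auto
  have pts: "\<exists>i\<in>{0, 1, 2}. x = (fst a + i * fst v, snd a + i * snd v)" if "x \<in> L" for x
    using that unfolding L k_line_3 by auto
  obtain i j where ij: "i \<in> {0, 1, 2}" "j \<in> {0, 1, 2}"
    and p: "p = (fst a + i * fst v, snd a + i * snd v)"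
    and q: "q = (fst a + j * fst v, snd a + j * snd v)"
    using pts[OF assms(2)] pts[OF assms(3)] by blast
  have "j - i \<in> {-2, -1, 1, 2}" using ij assms(4) unfolding p q by auto
  moreover have "\<forall>k\<in>{-2, -1, 1, 2}. \<forall>v\<in>directions. (k * fst v, k * snd v) \<in> queen_steps"
    unfolding directions_eq queen_steps_eq by simp
  ultimately have "((j - i) * fst v, (j - i) * snd v) \<in> queen_steps" using v by blast
  then show ?thesis unfolding p q by (simp add: algebra_simps)
qed

lemma queen_step_stays:
  assumes "p \<in> inner m n" "e \<in> queen_steps"
  shows "(fst p + fst e, snd p + snd e) \<in> board m n"
  using assms unfolding inner_def board_def queen_steps_eq by (cases p) auto

lemma inner_subset_board: "inner m n \<subseteq> board m n"
  unfolding inner_def board_def by auto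

text \<open>Two steps from the border, a line of three points can be drawn from \<open>p\<close> in each direction.
  Near a corner this may fail: \<open>(1, 2)\<close> and \<open>(2, 1)\<close> differ by a queen step, but no \<open>3\<close>-line of
  the board contains both.\<close>

lemma queen_step_imp_line:
  assumes p: "p \<in> inner m n" and e: "e \<in> queen_steps"
  shows "\<exists>L\<in>k_lines 3 (board m n). p \<in> L \<and> (fst p + fst e, snd p + snd e) \<in> L"
proof -
  obtain v where v: "v \<in> directions" and e': "e = v \<or> e = (2 * fst v, 2 * snd v)"
    using e unfolding queen_steps_def by blast
  have steps: "v \<in> queen_steps" "(2 * fst v, 2 * snd v) \<in> queen_steps"
    using v unfolding queen_steps_def by auto
  have "k_line 3 p v \<subseteq> board m n"
    using inner_subset_board p queen_step_stays[OF p steps(1)] queen_step_stays[OF p steps(2)]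
    unfolding k_line_3 by auto
  then have "k_line 3 p v \<in> k_lines 3 (board m n)"
    using v p inner_subset_board unfolding k_lines_def by blast
  moreover have "p \<in> k_line 3 p v" "(fst p + fst e, snd p + snd e) \<in> k_line 3 p v"
    using e' unfolding k_line_3 by auto
  ultimately show ?thesis by blast
qed

lemma configuration_inner_step:
  assumes S: "configuration 3 (board m n) S" and "p \<in> S" "p \<in> inner m n" "e \<in> queen_steps"
  shows "(fst p + fst e, snd p + snd e) \<notin> S"
proof
  assume "(fst p + fst e, snd p + snd e) \<in> S"
  moreover obtain L where "L \<in> k_lines 3 (board m n)" "p \<in> L" "(fst p + fst e, snd p + snd e) \<in> L"
    using queen_step_imp_line assms(3,4) by blast
  ultimately have "p = (fst p + fst e, snd p + snd e)"
    using S \<open>p \<in> S\<close> unfolding configuration_3_iff by blast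
  then have "e = (0, 0)" by (cases p; cases e) auto
  then show False using assms(4) unfolding queen_steps_eq by simp
qed

lemma configuration_if_no_step:
  assumes "S \<subseteq> B"
    and "\<And>p q. p \<in> S \<Longrightarrow> q \<in> S \<Longrightarrow> (fst q - fst p, snd q - snd p) \<notin> queen_steps"
  shows "configuration 3 B S"
  using assms line_imp_queen_step unfolding configuration_3_iff by blast

lemma configuration_extends:
  assumes "finite B" "configuration k B S"
  obtains T where "T \<in> saturated_configurations k B" "S \<subseteq> T"
proof -
  have "finite {T. configuration k B T}"
    by (rule finite_subset[of _ "Pow B"]) (auto simp: configuration_def assms(1))
  then obtain T where "configuration k B T" "S \<subseteq> T"
    "\<forall>U. configuration k B U \<longrightarrow> T \<subseteq> U \<longrightarrow> U = T"
    using finite_has_maximal2[of "{T. configuration k B T}" S] assms(2) by auto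
  then show ?thesis using that unfolding saturated_configurations_def by blast
qed

section \<open>Bounds valid for all configurations\<close>

lemma saturated_dominates:
  assumes S: "S \<in> saturated_configurations 3 B" and p: "p \<in> B" "p \<notin> S"
  shows "\<exists>s\<in>S. (fst p - fst s, snd p - snd s) \<in> queen_steps"
proof (rule ccontr)
  assume no: "\<not> ?thesis"
  have conf: "configuration 3 B S" and max: "\<And>T. configuration 3 B T \<Longrightarrow> S \<subseteq> T \<Longrightarrow> T = S"
    using S unfolding saturated_configurations_def by blast+
  have line: "s \<notin> L" if "L \<in> k_lines 3 B" "p \<in> L" "s \<in> S" for L s
    using line_imp_queen_step[OF that(1), of s p] that no p(2) by blast
  have "configuration 3 B (insert p S)"
    unfolding configuration_3_iff
  proof (intro conjI ballI)
    show "insert p S \<subseteq> B" using conf p(1) unfolding configuration_def by auto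
    fix L a b assume "L \<in> k_lines 3 B" "a \<in> L \<inter> insert p S" "b \<in> L \<inter> insert p S"
    then show "a = b" using line conf unfolding configuration_3_iff by blast
  qed
  from max[OF this] p(2) show False by blast
qed

lemma saturated_card_lower:
  assumes S: "S \<in> saturated_configurations 3 B" and fin: "finite B"
  shows "card B \<le> 17 * card S"
proof -
  define ball where "ball s = (\<lambda>e. (fst s + fst e, snd s + snd e)) ` insert (0, 0) queen_steps"
    for s :: point
  have S_fin: "finite S"
    using S fin unfolding saturated_configurations_def configuration_def
    by (auto intro: finite_subset)
  have "p \<in> (\<Union>s\<in>S. ball s)" if p: "p \<in> B" for p
  proof (cases "p \<in> S")
    case True
    then show ?thesis unfolding ball_def by (intro UN_I[of p]) auto
  next
    case False
    then obtain s where "s \<in> S" "(fst p - fst s, snd p - snd s) \<in> queen_steps"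
      using saturated_dominates[OF S p] by blast
    then have "p \<in> ball s"
      unfolding ball_def by (intro image_eqI[of _ _ "(fst p - fst s, snd p - snd s)"]) auto
    with \<open>s \<in> S\<close> show ?thesis by blast
  qed
  then have "B \<subseteq> (\<Union>s\<in>S. ball s)" by blast
  moreover have fin_ball: "finite (ball s)" for s unfolding ball_def queen_steps_eq by simp
  ultimately have "card B \<le> card (\<Union>s\<in>S. ball s)" using S_fin by (intro card_mono) auto
  also have "\<dots> \<le> (\<Sum>s\<in>S. card (ball s))" by (rule card_UN_le[OF S_fin])
  also have "\<dots> \<le> (\<Sum>s\<in>S. 17)"
  proof (rule sum_mono)
    fix s
    have "finite (insert (0, 0) queen_steps)" and card: "card (insert (0, 0) queen_steps) = 17"
      unfolding queen_steps_eq by simp_all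
    then show "card (ball s) \<le> 17"
      unfolding ball_def card[symmetric] by (intro card_image_le)
  qed
  finally show ?thesis by simp
qed

lemma card_border_le: "card (board m n - inner m n) \<le> 4 * (m + n)"
proof -
  let ?X = "{1, 2, int m - 1, int m} \<times> {1..int n}" and ?Y = "{1..int m} \<times> {1, 2, int n - 1, int n}"
  have four: "card {a, b, c, d} \<le> 4" for a b c d :: int
    by (intro card_insert_le_m1) auto
  have side: "card {1..int k} = k" for k by simp
  have "card (board m n - inner m n) \<le> card (?X \<union> ?Y)"
    by (rule card_mono) (auto simp: board_def inner_def)
  also have "\<dots> \<le> card ?X + card ?Y" by (rule card_Un_le)
  also have "\<dots> \<le> 4 * n + 4 * m"
    unfolding card_cartesian_product side
    using mult_le_mono1[OF four[of 1 2 "int m - 1" "int m"], of n]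
      mult_le_mono2[OF four[of 1 2 "int n - 1" "int n"], of m]
    by linarith
  finally show ?thesis by simp
qed

definition plus :: "point set" where
  "plus = {(0, 0), (1, 0), (-1, 0), (0, 1), (0, -1)}"

lemma plus_diff:
  assumes "e \<in> plus" "f \<in> plus" "e \<noteq> f"
  shows "(fst e - fst f, snd e - snd f) \<in> queen_steps"
proof -
  have "\<forall>e\<in>plus. \<forall>f\<in>plus. e \<noteq> f \<longrightarrow> (fst e - fst f, snd e - snd f) \<in> queen_steps"
    unfolding plus_def queen_steps_eq by simp
  with assms show ?thesis by blast
qed

text \<open>Pluses around different inner points of \<open>S\<close> are disjoint, because a common point would make
  the two centres differ by a difference of two points of the plus, hence by a queen step. The
  points of \<open>S\<close> near the border are bounded by the size of the border.\<close>

lemma configuration_card_upper: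
  assumes S: "configuration 3 (board m n) S"
  shows "5 * card S \<le> m * n + 5 * (4 * (m + n))"
proof -
  let ?I = "S \<inter> inner m n" and ?add = "\<lambda>(s, e). (fst s + fst e, snd s + snd e) :: point"
  have SB: "S \<subseteq> board m n" using S unfolding configuration_def by blast
  have inj: "inj_on ?add (?I \<times> plus)"
  proof (rule inj_onI)
    fix x y assume x: "x \<in> ?I \<times> plus" and y: "y \<in> ?I \<times> plus" and eq: "?add x = ?add y"
    obtain s e t f where xy: "x = (s, e)" "y = (t, f)" by (cases x; cases y)
    have t: "t = (fst s + (fst e - fst f), snd s + (snd e - snd f))"
      using eq unfolding xy by (cases t) auto
    have "e = f"
    proof (rule ccontr)
      assume "e \<noteq> f"
      then have "(fst e - fst f, snd e - snd f) \<in> queen_steps"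
        using x y unfolding xy by (intro plus_diff) blast+
      then have "(fst s + (fst e - fst f), snd s + (snd e - snd f)) \<notin> S"
        using configuration_inner_step[OF S, of s] x unfolding xy by fastforce
      with t y show False unfolding xy by blast
    qed
    with t show "x = y" unfolding xy by simp
  qed
  have "?add ` (?I \<times> plus) \<subseteq> board m n"
    unfolding plus_def inner_def board_def by auto
  then have "card (?add ` (?I \<times> plus)) \<le> card (board m n)" by (rule card_mono[OF finite_board])
  then have "card (?I \<times> plus) \<le> m * n" unfolding card_image[OF inj] card_board .
  then have "5 * card ?I \<le> m * n"
    unfolding card_cartesian_product by (simp add: plus_def)
  moreover have "card (S - inner m n) \<le> 4 * (m + n)"
    by (rule order_trans[OF card_mono card_border_le]) (use SB in auto)
  moreover have "card S = card ?I + card (S - inner m n)"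
    using SB by (metis card_Int_Diff finite_board finite_subset)
  ultimately show ?thesis by linarith
qed

section \<open>Periodic configurations\<close>

definition residue_class :: "int \<Rightarrow> nat \<Rightarrow> nat \<Rightarrow> point set" where
  "residue_class b r c = {p. (fst p + b * snd p) mod int r = int c}"

lemma residue_class_configuration:
  assumes "\<And>e. e \<in> queen_steps \<Longrightarrow> \<not> int r dvd fst e + b * snd e"
  shows "configuration 3 B (B \<inter> residue_class b r c)"
proof (rule configuration_if_no_step)
  fix p q assume "p \<in> B \<inter> residue_class b r c" "q \<in> B \<inter> residue_class b r c"
  then have "(fst q + b * snd q) mod int r = (fst p + b * snd p) mod int r"
    unfolding residue_class_def by simp
  then have "int r dvd (fst q - fst p) + b * (snd q - snd p)"
    by (simp add: mod_eq_dvd_iff algebra_simps)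
  then show "(fst q - fst p, snd q - snd p) \<notin> queen_steps"
    using assms[of "(fst q - fst p, snd q - snd p)"] by auto
qed simp

lemma card_residue_classes:
  assumes "finite B" "r > 0"
  shows "(\<Sum>c<r. card (B \<inter> residue_class b r c)) = card B"
proof -
  have "B = (\<Union>c<r. B \<inter> residue_class b r c)"
  proof (intro equalityI subsetI)
    fix p assume "p \<in> B"
    moreover have "nat ((fst p + b * snd p) mod int r) < r"
      using assms(2) by (simp add: nat_less_iff)
    ultimately show "p \<in> (\<Union>c<r. B \<inter> residue_class b r c)"
      using assms(2) by (intro UN_I[of "nat ((fst p + b * snd p) mod int r)"])
        (auto simp: residue_class_def)
  qed auto
  moreover have "card (\<Union>c<r. B \<inter> residue_class b r c) = (\<Sum>c<r. card (B \<inter> residue_class b r c))"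
    by (rule card_UN_disjoint) (auto simp: assms(1) residue_class_def)
  ultimately show ?thesis by simp
qed

lemma sparse_residue_class:
  assumes "finite B" "r > 0"
  shows "\<exists>c<r. r * card (B \<inter> residue_class b r c) \<le> card B"
proof (rule ccontr)
  assume "\<not> ?thesis"
  then have "card B < r * card (B \<inter> residue_class b r c)" if "c < r" for c
    using that by (meson not_le)
  then have "(\<Sum>c<r. card B) < (\<Sum>c<r. r * card (B \<inter> residue_class b r c))"
    using assms(2) by (intro sum_strict_mono) auto
  then show False
    by (simp add: card_residue_classes[OF assms] sum_distrib_left[symmetric])
qed

lemma dense_residue_class:
  assumes "finite B" "r > 0"
  shows "\<exists>c<r. card B \<le> r * card (B \<inter> residue_class b r c)"
proof (rule ccontr)
  assume "\<not> ?thesis"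
  then have "r * card (B \<inter> residue_class b r c) < card B" if "c < r" for c
    using that by (meson not_le)
  then have "(\<Sum>c<r. r * card (B \<inter> residue_class b r c)) < (\<Sum>c<r. card B)"
    using assms(2) by (intro sum_strict_mono) auto
  then show False
    by (simp add: card_residue_classes[OF assms] sum_distrib_left[symmetric])
qed

lemma dense_saturated:
  obtains S where "S \<in> saturated_configurations 3 (board m n)" "m * n \<le> 5 * card S"
proof -
  obtain c where c: "m * n \<le> 5 * card (board m n \<inter> residue_class 2 5 c)"
    using dense_residue_class[of "board m n" 5 2] by auto
  have "configuration 3 (board m n) (board m n \<inter> residue_class 2 5 c)"
    by (rule residue_class_configuration) (auto simp: queen_steps_eq)
  then obtain S where S: "S \<in> saturated_configurations 3 (board m n)"
    "board m n \<inter> residue_class 2 5 c \<subseteq> S"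
    using configuration_extends[OF finite_board] by blast
  then have "card (board m n \<inter> residue_class 2 5 c) \<le> card S"
    unfolding saturated_configurations_def configuration_def
    by (auto intro: card_mono finite_subset[OF _ finite_board])
  with c S(1) show ?thesis using that by fastforce
qed

text \<open>The residues modulo 17 of the queen steps under \<open>x + 4 y\<close> are \<open>\<plusminus>1, \<plusminus>2\<close> times
  \<open>1, 4, 5, 3\<close>, and these are all nonzero residues; this is what makes the code perfect.\<close>

lemma perfect_code_dominates:
  assumes "c < 17" "p \<notin> residue_class 4 17 c"
  shows "\<exists>e\<in>queen_steps. (fst p + fst e, snd p + snd e) \<in> residue_class 4 17 c"
proof -
  define z where "z = fst p + 4 * snd p"
  have nz: "z mod 17 \<noteq> int c" using assms(2) unfolding residue_class_def z_def by simp
  define d where "d = (int c - z) mod 17"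
  have "\<exists>e\<in>queen_steps. (fst e + 4 * snd e) mod 17 = d"
  proof -
    have "d \<noteq> 0"
    proof
      assume "d = 0"
      then have "int c mod 17 = z mod 17" unfolding d_def
        by (metis mod_eq_dvd_iff dvd_eq_mod_eq_0)
      with nz assms(1) show False by simp
    qed
    moreover have "0 \<le> d" "d < 17" unfolding d_def by simp_all
    ultimately have "d \<in> {1, 2, 3, 4, 5, 6, 7, 8, 9, 10, 11, 12, 13, 14, 15, 16}"
      by simp presburger
    then show ?thesis unfolding queen_steps_eq by auto
  qed
  then obtain e where e: "e \<in> queen_steps" "(fst e + 4 * snd e) mod 17 = d" by blast
  have "(z + (fst e + 4 * snd e)) mod 17 = (z + (int c - z)) mod 17"
    using e(2) unfolding d_def by (metis mod_add_right_eq)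
  then have "(fst p + fst e + 4 * (snd p + snd e)) mod 17 = int c"
    using assms(1) unfolding z_def by (simp add: algebra_simps)
  with e(1) show ?thesis unfolding residue_class_def by auto
qed

text \<open>In the extension of a sparse residue class to a saturated configuration, an added inner
  point would be a queen step away from the class, which dominates the plane.\<close>

lemma sparse_saturated:
  obtains S where "S \<in> saturated_configurations 3 (board m n)"
    "17 * card S \<le> m * n + 17 * (4 * (m + n))"
proof -
  obtain c where c17: "c < 17" and c: "17 * card (board m n \<inter> residue_class 4 17 c) \<le> m * n"
    using sparse_residue_class[of "board m n" 17 4] by auto
  have "configuration 3 (board m n) (board m n \<inter> residue_class 4 17 c)"
    by (rule residue_class_configuration) (auto simp: queen_steps_eq)
  then obtain S where S: "S \<in> saturated_configurations 3 (board m n)"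
    and sup: "board m n \<inter> residue_class 4 17 c \<subseteq> S"
    using configuration_extends[OF finite_board] by blast
  have conf: "configuration 3 (board m n) S" using S unfolding saturated_configurations_def by blast
  have "S \<subseteq> (board m n \<inter> residue_class 4 17 c) \<union> (board m n - inner m n)"
  proof
    fix p assume p: "p \<in> S"
    then have "p \<in> board m n" using conf unfolding configuration_def by blast
    moreover have "p \<in> residue_class 4 17 c" if inn: "p \<in> inner m n"
    proof (rule ccontr)
      assume "p \<notin> residue_class 4 17 c"
      then obtain e where e: "e \<in> queen_steps"
        "(fst p + fst e, snd p + snd e) \<in> residue_class 4 17 c"
        using perfect_code_dominates c17 by blast
      then have "(fst p + fst e, snd p + snd e) \<in> S"
        using queen_step_stays[OF inn] sup by blast
      with configuration_inner_step[OF conf p inn e(1)] show False by blast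
    qed
    ultimately show "p \<in> (board m n \<inter> residue_class 4 17 c) \<union> (board m n - inner m n)" by blast
  qed
  then have "card S \<le> card ((board m n \<inter> residue_class 4 17 c) \<union> (board m n - inner m n))"
    by (intro card_mono) auto
  also have "\<dots> \<le> card (board m n \<inter> residue_class 4 17 c) + card (board m n - inner m n)"
    by (rule card_Un_le)
  finally have "17 * card S \<le> m * n + 17 * (4 * (m + n))"
    using c card_border_le[of m n] by linarith
  with S show ?thesis using that by blast
qed

section \<open>Densities and their limits\<close>

lemma finite_saturated_configurations:
  assumes "finite B"
  shows "finite (saturated_configurations k B)"
  by (rule finite_subset[of _ "Pow B"])
    (auto simp: saturated_configurations_def configuration_def assms)

lemma density_error:
  assumes "m \<ge> 1" "n \<ge> 1" "r > 0" "r * k \<le> m * n + r * (4 * (m + n))"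
  shows "real k / real (m * n) \<le> 1 / real r + (4 / real m + 4 / real n)"
proof -
  have "real (r * k) \<le> real (m * n + r * (4 * (m + n)))" using assms(4) by (rule of_nat_mono)
  then show ?thesis using assms(1-3) by (simp add: field_simps)
qed

lemma max_density_bounds:
  assumes "m \<ge> 1" "n \<ge> 1"
  shows "1 / 5 \<le> max_density 3 (board m n)"
    and "max_density 3 (board m n) \<le> 1 / 5 + (4 / real m + 4 / real n)"
proof -
  let ?D = "(\<lambda>S. real (card S) / real (card (board m n))) ` saturated_configurations 3 (board m n)"
  have fin: "finite ?D" by (simp add: finite_saturated_configurations)
  obtain S where S: "S \<in> saturated_configurations 3 (board m n)" "m * n \<le> 5 * card S"
    by (rule dense_saturated)
  have "real (m * n) \<le> real (5 * card S)" using S(2) by (rule of_nat_mono)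
  then have "1 / 5 \<le> real (card S) / real (card (board m n))"
    using assms by (simp add: field_simps)
  also have "\<dots> \<le> max_density 3 (board m n)"
    unfolding max_density_def using S(1) fin by (intro Max_ge) auto
  finally show "1 / 5 \<le> max_density 3 (board m n)" .
  have "real (card T) / real (card (board m n)) \<le> 1 / 5 + (4 / real m + 4 / real n)"
    if "T \<in> saturated_configurations 3 (board m n)" for T
    using density_error[OF assms, of 5 "card T"] configuration_card_upper that
    unfolding saturated_configurations_def by auto
  then show "max_density 3 (board m n) \<le> 1 / 5 + (4 / real m + 4 / real n)"
    unfolding max_density_def using S(1) fin by (subst Max_le_iff) auto
qed

lemma min_density_bounds:
  assumes "m \<ge> 1" "n \<ge> 1"
  shows "1 / 17 \<le> min_density 3 (board m n)"
    and "min_density 3 (board m n) \<le> 1 / 17 + (4 / real m + 4 / real n)"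
proof -
  let ?D = "(\<lambda>S. real (card S) / real (card (board m n))) ` saturated_configurations 3 (board m n)"
  have fin: "finite ?D" by (simp add: finite_saturated_configurations)
  obtain S where S: "S \<in> saturated_configurations 3 (board m n)"
    "17 * card S \<le> m * n + 17 * (4 * (m + n))"
    by (rule sparse_saturated)
  have "min_density 3 (board m n) \<le> real (card S) / real (card (board m n))"
    unfolding min_density_def using S(1) fin by (intro Min_le) auto
  also have "\<dots> \<le> 1 / 17 + (4 / real m + 4 / real n)"
    using density_error[OF assms _ S(2)] by simp
  finally show "min_density 3 (board m n) \<le> 1 / 17 + (4 / real m + 4 / real n)" .
  have "1 / 17 \<le> real (card T) / real (card (board m n))"
    if "T \<in> saturated_configurations 3 (board m n)" for T
  proof -
    have "real (m * n) \<le> real (17 * card T)"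
      using saturated_card_lower[OF that] by (intro of_nat_mono) simp
    then show ?thesis using assms by (simp add: field_simps)
  qed
  then show "1 / 17 \<le> min_density 3 (board m n)"
    unfolding min_density_def using S(1) fin by (subst Min_ge_iff) auto
qed

lemma board_limit_squeeze:
  assumes "\<And>m n. m \<ge> 1 \<Longrightarrow> n \<ge> 1 \<Longrightarrow> l \<le> f (board m n)"
    and "\<And>m n. m \<ge> 1 \<Longrightarrow> n \<ge> 1 \<Longrightarrow> f (board m n) \<le> l + (4 / real m + 4 / real n)"
  shows "board_limit f l"
  unfolding board_limit_def
proof (intro allI impI, elim conjE)
  fix m n :: "nat \<Rightarrow> nat"
  assume pos: "\<forall>t\<ge>1. m t \<ge> 1 \<and> n t \<ge> 1"
    and lim: "filterlim m at_top sequentially" "filterlim n at_top sequentially"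
  have zero: "(\<lambda>t. 4 / real (g t)) \<longlonglongrightarrow> 0" if "filterlim g at_top sequentially" for g
    using filterlim_compose[OF filterlim_real_sequentially that]
    by (intro tendsto_divide_0[OF tendsto_const] filterlim_at_top_imp_at_infinity)
  have "(\<lambda>t. l + (4 / real (m t) + 4 / real (n t))) \<longlonglongrightarrow> l + (0 + 0)"
    by (intro tendsto_intros zero lim)
  then have upper: "(\<lambda>t. l + (4 / real (m t) + 4 / real (n t))) \<longlonglongrightarrow> l" by simp
  show "(\<lambda>t. f (board (m t) (n t))) \<longlonglongrightarrow> l"
  proof (rule tendsto_sandwich[OF _ _ tendsto_const upper])
    show "\<forall>\<^sub>F t in sequentially. l \<le> f (board (m t) (n t))"
      using eventually_ge_at_top[of 1] by eventually_elim (use pos assms(1) in auto)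
    show "\<forall>\<^sub>F t in sequentially. f (board (m t) (n t)) \<le> l + (4 / real (m t) + 4 / real (n t))"
      using eventually_ge_at_top[of 1] by eventually_elim (use pos assms(2) in auto)
  qed
qed

lemma board_limit_unique:
  assumes "board_limit f l" "board_limit f l'"
  shows "l = l'"
proof -
  have "(\<lambda>t. f (board t t)) \<longlonglongrightarrow> a" if "board_limit f a" for a
    using that unfolding board_limit_def by (auto dest!: spec[of _ "\<lambda>t. t"] simp: filterlim_ident)
  with assms show ?thesis using LIMSEQ_unique by blast
qed

theorem mainTheorem1:
  shows "board_limit (max_density 3) (plane_max_density 3) \<and> plane_max_density 3 = 1 / 5 \<and>
         board_limit (min_density 3) (plane_min_density 3) \<and> plane_min_density 3 = 1 / 17"
proof -
  have D: "board_limit (max_density 3) (1 / 5)"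
    by (rule board_limit_squeeze) (use max_density_bounds in auto)
  have d: "board_limit (min_density 3) (1 / 17)"
    by (rule board_limit_squeeze) (use min_density_bounds in auto)
  have "plane_max_density 3 = 1 / 5"
    unfolding plane_max_density_def by (rule the_equality, rule D) (rule board_limit_unique[OF _ D])
  moreover have "plane_min_density 3 = 1 / 17"
    unfolding plane_min_density_def by (rule the_equality, rule d) (rule board_limit_unique[OF _ d])
  ultimately show ?thesis using D d by metis
qed

end
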